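(* Let $X$ be a finite dimensional locally finite CW-complex (for instance, any open differentiable $n$-manifold or any open PL $n$-manifold). Then its Alexandroff compactification $X^+$ is paracompact. As a consequence, if $\{X_\alpha\}_{\alpha\in A}$ is a covering of $X$ such that the family of interiors $\{\mathrm{int}(X_\alpha)\}_{\alpha\in A}$ also covers $X$ and there exists $\alpha\in A$ such that the complement $X\setminus \mathrm{int}(X_\alpha)$ is compact, then $\{X_\alpha\}_{\alpha\in A}$ is a p-numerable covering of $X$.
   Context: For a topological space $X$, the Alexandroff compactification is $X^+=X\cup\{\infty\}$ (with $\infty\notin X$), whose open sets are the open sets of $X$ together with the sets $(X\setminus K)\cup\{\infty\}$ with $K$ a closed compact subset of $X$ (if $X$ is compact, $\infty$ is an isolated point). A space is paracompact if every open covering admits a locally finite open refinement. A (not necessarily open) covering $\mathcal{U}$ of a topological space $Z$ is numerable if it admits a refinement by a partition of unity, i.e. there is a locally finite partition of unity $\{\pi_\gamma\}_\gamma$ on $Z$ such that each set $\pi_\gamma^{-1}((0,1])$ is contained in some member of $\mathcal{U}$. A covering $\{U_i\}_{i\in I}$ of a space $X$ (members not necessarily open) is a p-numerable (proper numerable) covering if $\{U_i\cup\{\infty\}\}_{i\in I}$ is a numerable covering of $X^+$. *)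

theory Defs
  imports "HOL-Analysis.Analysis"
begin

definition unit_disk :: "nat \<Rightarrow> (nat \<Rightarrow> real) topology" where
  "unit_disk n = subtopology (Euclidean_space n) {x. (\<Sum>i<n. (x i)\<^sup>2) \<le> 1}"

definition open_unit_disk :: "nat \<Rightarrow> (nat \<Rightarrow> real) set" where
  "open_unit_disk n = {x \<in> topspace (Euclidean_space n). (\<Sum>i<n. (x i)\<^sup>2) < 1}"

definition unit_sphere :: "nat \<Rightarrow> (nat \<Rightarrow> real) set" where
  "unit_sphere n = {x \<in> topspace (Euclidean_space n). (\<Sum>i<n. (x i)\<^sup>2) = 1}"

definition characteristic_map ::
    "'a topology \<Rightarrow> 'a set \<Rightarrow> nat \<Rightarrow> ((nat \<Rightarrow> real) \<Rightarrow> 'a) \<Rightarrow> bool" where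
  "characteristic_map X e n \<phi> \<longleftrightarrow>
     continuous_map (unit_disk n) X \<phi> \<and>
     homeomorphic_map (subtopology (unit_disk n) (open_unit_disk n)) (subtopology X e) \<phi>"

(* Whitehead's definition. The (open) cells are pairwise disjoint and nonempty, so the set of
   cells \<E> serves as its own index set; d gives the dimension of each cell. The last two
   conjuncts are closure finiteness (with the boundary in cells of smaller dimension) and the
   weak topology. *)
definition cw_complex :: "'a topology \<Rightarrow> 'a set set \<Rightarrow> ('a set \<Rightarrow> nat) \<Rightarrow> bool" where
  "cw_complex X \<E> d \<longleftrightarrow>
     Hausdorff_space X \<and>
     partition_on (topspace X) \<E> \<and>
     (\<forall>e\<in>\<E>. \<exists>\<phi>. characteristic_map X e (d e) \<phi> \<and>
        (\<exists>\<F>. finite \<F> \<and> \<F> \<subseteq> {c \<in> \<E>. d c < d e} \<and> \<phi> ` unit_sphere (d e) \<subseteq> \<Union>\<F>)) \<and>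
     (\<forall>S. S \<subseteq> topspace X \<longrightarrow>
        (closedin X S \<longleftrightarrow> (\<forall>e\<in>\<E>. closedin X (S \<inter> X closure_of e))))"

(* No separation axiom is included. *)
definition paracompact_space :: "'a topology \<Rightarrow> bool" where
  "paracompact_space Z \<longleftrightarrow>
     (\<forall>\<U>. (\<forall>U\<in>\<U>. openin Z U) \<and> \<Union>\<U> = topspace Z \<longrightarrow>
        (\<exists>\<V>. (\<forall>V\<in>\<V>. openin Z V) \<and> \<Union>\<V> = topspace Z \<and>
              (\<forall>V\<in>\<V>. \<exists>U\<in>\<U>. V \<subseteq> U) \<and> locally_finite_in Z \<V>))"

(* Local finiteness makes the sum over the indices with nonzero value a finite sum. *)
definition locally_finite_partition_of_unity ::
    "'a topology \<Rightarrow> 'g set \<Rightarrow> ('g \<Rightarrow> 'a \<Rightarrow> real) \<Rightarrow> bool" where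
  "locally_finite_partition_of_unity Z \<Gamma> \<pi> \<longleftrightarrow>
     (\<forall>\<gamma>\<in>\<Gamma>. continuous_map Z (top_of_set {0..1}) (\<pi> \<gamma>)) \<and>
     (\<forall>z\<in>topspace Z. \<exists>V. openin Z V \<and> z \<in> V \<and> finite {\<gamma> \<in> \<Gamma>. \<exists>y\<in>V. \<pi> \<gamma> y \<noteq> 0}) \<and>
     (\<forall>z\<in>topspace Z. (\<Sum>\<gamma> | \<gamma> \<in> \<Gamma> \<and> \<pi> \<gamma> z \<noteq> 0. \<pi> \<gamma> z) = 1)"

definition covering :: "'a topology \<Rightarrow> 'i set \<Rightarrow> ('i \<Rightarrow> 'a set) \<Rightarrow> bool" where
  "covering Z I U \<longleftrightarrow> (\<Union>i\<in>I. U i) = topspace Z"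

(* HOL cannot quantify over index types, so a type large enough for every case is fixed: only
   finitely many members of a locally finite family are nonzero at a given point of Z, so its
   not identically vanishing members can be indexed injectively by pairs (point, number). *)
definition numerable_covering :: "'a topology \<Rightarrow> 'i set \<Rightarrow> ('i \<Rightarrow> 'a set) \<Rightarrow> bool" where
  "numerable_covering Z I U \<longleftrightarrow>
     covering Z I U \<and>
     (\<exists>(\<Gamma> :: ('a \<times> nat) set) \<pi>. locally_finite_partition_of_unity Z \<Gamma> \<pi> \<and>
        (\<forall>\<gamma>\<in>\<Gamma>. \<exists>i\<in>I. {z \<in> topspace Z. \<pi> \<gamma> z \<in> {0<..1}} \<subseteq> U i))"

(* In the library's Alexandroff compactification, None is the point at infinity. *)
definition p_numerable_covering :: "'a topology \<Rightarrow> 'i set \<Rightarrow> ('i \<Rightarrow> 'a set) \<Rightarrow> bool" where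
  "p_numerable_covering X I U \<longleftrightarrow>
     covering X I U \<and>
     numerable_covering (Alexandroff_compactification X) I (\<lambda>i. insert None (Some ` U i))"

end

theory Submission
  imports Defs
begin

text \<open>
  The Alexandroff compactification of any space is compact, hence paracompact: a finite subcover
  is a locally finite refinement.

  For numerability, the compactification must have enough continuous functions, and a compact
  Hausdorff space has them. Since \<open>X\<close> is Hausdorff, its compactification is Hausdorff if and only
  if \<open>X\<close> is locally compact. This is where the CW structure
  enters (\<open>locally_finite_cw_complex_imp_locally_compact\<close>): each open cell lies in the image of a
  closed disk under its characteristic map, which is compact, and a neighbourhood that meets only
  finitely many cells lies in the union of finitely many such images.

  The interiors of the sets \<open>X\<^sub>\<alpha> \<union> {\<infinity>}\<close> in the compactification cover it: they contain
  the interiors of the \<open>X\<^sub>\<alpha>\<close> in \<open>X\<close>, and the index whose interior has compact complement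
  accounts for a neighbourhood of \<open>\<infinity>\<close>. On a compact completely regular space every covering
  by sets whose interiors cover is numerable
  (\<open>compact_completely_regular_imp_numerable_covering\<close>): finitely many bump functions, each
  vanishing outside one of these interiors, have a positive sum, and dividing by the sum makes them a
  partition of unity.
\<close>

section \<open>Coverings of compact spaces\<close>

lemma compact_imp_paracompact_space:
  assumes "compact_space Z"
  shows "paracompact_space Z"
  unfolding paracompact_space_def
proof (intro allI impI)
  fix \<U> assume \<U>: "(\<forall>U\<in>\<U>. openin Z U) \<and> \<Union>\<U> = topspace Z"
  then obtain \<F> where "finite \<F>" "\<F> \<subseteq> \<U>" "\<Union>\<F> = topspace Z"
    using assms unfolding compact_space by metis
  with \<U> show "\<exists>\<V>. (\<forall>V\<in>\<V>. openin Z V) \<and> \<Union>\<V> = topspace Z \<and>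
                (\<forall>V\<in>\<V>. \<exists>U\<in>\<U>. V \<subseteq> U) \<and> locally_finite_in Z \<V>"
    by (intro exI[of _ \<F>]) (auto intro: finite_imp_locally_finite_in)
qed

text \<open>
  Complete regularity gives each point a bump function that is 1 there and vanishes outside the
  interior of some member. The sets where these functions are positive cover the space, so by
  compactness finitely many points suffice for the sum to be positive everywhere. The same points,
  each paired with 0, index the partition of unity.
\<close>

lemma compact_completely_regular_imp_numerable_covering:
  fixes Z :: "'a topology"
  assumes compact: "compact_space Z" and creg: "completely_regular_space Z"
    and cov: "covering Z I U"
    and interiors: "topspace Z \<subseteq> (\<Union>i\<in>I. Z interior_of U i)"
  shows "numerable_covering Z I U"
proof -
  have "\<exists>i f. i \<in> I \<and> continuous_map Z (top_of_set {0..1::real}) f \<and> f z = 1 \<and>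
              (\<forall>y \<in> topspace Z - Z interior_of U i. f y = 0)" if "z \<in> topspace Z" for z
  proof -
    obtain i where i: "i \<in> I" "z \<in> Z interior_of U i"
      using subsetD[OF interiors \<open>z \<in> topspace Z\<close>] by auto
    have "closedin Z (topspace Z - Z interior_of U i)"
      by (intro closedin_diff) auto
    moreover have "z \<in> topspace Z - (topspace Z - Z interior_of U i)"
      using \<open>z \<in> topspace Z\<close> i(2) by auto
    ultimately obtain g where g: "continuous_map Z (top_of_set {0..1::real}) g" "g z = 0"
        "g ` (topspace Z - Z interior_of U i) \<subseteq> {1}"
      using creg unfolding completely_regular_space_def by meson
    have "continuous_map Z (top_of_set {0..1::real}) (\<lambda>y. 1 - g y)"
      using g(1) by (auto simp: continuous_map_in_subtopology Pi_iff intro!: continuous_intros)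
    with g i(1) show ?thesis
      by (intro exI[of _ i] exI[of _ "\<lambda>y. 1 - g y"]) auto
  qed
  then obtain i f where i: "\<And>z. z \<in> topspace Z \<Longrightarrow> i z \<in> I"
    and cont: "\<And>z. z \<in> topspace Z \<Longrightarrow> continuous_map Z (top_of_set {0..1::real}) (f z)"
    and one: "\<And>z. z \<in> topspace Z \<Longrightarrow> f z z = 1"
    and zero: "\<And>z y. \<lbrakk>z \<in> topspace Z; y \<in> topspace Z - Z interior_of U (i z)\<rbrakk> \<Longrightarrow> f z y = 0"
    by metis
  have cont_real: "continuous_map Z euclideanreal (f z)" if "z \<in> topspace Z" for z
    using cont[OF that] by (simp add: continuous_map_in_subtopology)
  have nonneg: "0 \<le> f z y" if "z \<in> topspace Z" "y \<in> topspace Z" for z y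
    using cont[OF that(1)] that(2) by (auto simp: continuous_map_in_subtopology Pi_iff)

  define V where "V z = {y \<in> topspace Z. f z y \<in> {0<..}}" for z
  have "openin Z (V z)" if "z \<in> topspace Z" for z
    unfolding V_def using cont_real[OF that] by (rule openin_continuous_map_preimage) simp
  then have "\<forall>W \<in> V ` topspace Z. openin Z W"
    by blast
  moreover have "topspace Z \<subseteq> \<Union>(V ` topspace Z)"
    using one by (force simp: V_def)
  ultimately obtain \<F> where "finite \<F>" "\<F> \<subseteq> V ` topspace Z" "topspace Z \<subseteq> \<Union>\<F>"
    using compact unfolding compact_space_alt by metis
  then obtain F where F: "finite F" "F \<subseteq> topspace Z" "topspace Z \<subseteq> \<Union>(V ` F)"
    by (metis finite_subset_image)

  define s where "s y = (\<Sum>z\<in>F. f z y)" for y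
  have s_pos: "0 < s y" if "y \<in> topspace Z" for y
  proof -
    obtain z where "z \<in> F" "0 < f z y"
      using F(3) \<open>y \<in> topspace Z\<close> by (auto simp: V_def)
    then show ?thesis
      unfolding s_def using F nonneg that by (intro sum_pos2[of F z]) auto
  qed
  have s_cont: "continuous_map Z euclideanreal s"
    unfolding s_def using F cont_real by (intro continuous_map_sum) auto
  have le_s: "f z y \<le> s y" if "z \<in> F" "y \<in> topspace Z" for z y
    unfolding s_def using F nonneg that by (intro member_le_sum) auto

  define \<Gamma> :: "('a \<times> nat) set" where "\<Gamma> = F \<times> {0}"
  define \<pi> :: "'a \<times> nat \<Rightarrow> 'a \<Rightarrow> real" where "\<pi> \<gamma> y = f (fst \<gamma>) y / s y" for \<gamma> y
  have "finite \<Gamma>"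
    using F by (simp add: \<Gamma>_def)
  have "locally_finite_partition_of_unity Z \<Gamma> \<pi>"
    unfolding locally_finite_partition_of_unity_def
  proof (intro conjI ballI)
    fix \<gamma> assume "\<gamma> \<in> \<Gamma>"
    then have \<gamma>: "fst \<gamma> \<in> F" "fst \<gamma> \<in> topspace Z"
      using F by (auto simp: \<Gamma>_def)
    have "continuous_map Z euclideanreal (\<pi> \<gamma>)"
      unfolding \<pi>_def using cont_real[OF \<gamma>(2)] s_cont s_pos
      by (intro continuous_map_real_divide) (auto simp: less_imp_neq[symmetric])
    moreover have "\<pi> \<gamma> y \<in> {0..1}" if "y \<in> topspace Z" for y
      using nonneg[OF \<gamma>(2) that] le_s[OF \<gamma>(1) that] s_pos[OF that] by (simp add: \<pi>_def)
    ultimately show "continuous_map Z (top_of_set {0..1}) (\<pi> \<gamma>)"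
      by (simp add: continuous_map_in_subtopology Pi_iff)
  next
    fix z assume "z \<in> topspace Z"
    then show "\<exists>V. openin Z V \<and> z \<in> V \<and> finite {\<gamma> \<in> \<Gamma>. \<exists>y\<in>V. \<pi> \<gamma> y \<noteq> 0}"
      using \<open>finite \<Gamma>\<close> by (intro exI[of _ "topspace Z"]) auto
  next
    fix z assume z: "z \<in> topspace Z"
    have "(\<Sum>\<gamma> | \<gamma> \<in> \<Gamma> \<and> \<pi> \<gamma> z \<noteq> 0. \<pi> \<gamma> z) = (\<Sum>\<gamma>\<in>\<Gamma>. \<pi> \<gamma> z)"
      using \<open>finite \<Gamma>\<close> by (intro sum.mono_neutral_left) auto
    also have "\<dots> = (\<Sum>x\<in>F. f x z / s z)"
      unfolding \<Gamma>_def \<pi>_def by (simp add: sum.cartesian_product')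
    also have "\<dots> = 1"
      using s_pos[OF z] by (simp add: s_def flip: sum_divide_distrib)
    finally show "(\<Sum>\<gamma> | \<gamma> \<in> \<Gamma> \<and> \<pi> \<gamma> z \<noteq> 0. \<pi> \<gamma> z) = 1" .
  qed
  moreover have "\<exists>i\<in>I. {z \<in> topspace Z. \<pi> \<gamma> z \<in> {0<..1}} \<subseteq> U i" if "\<gamma> \<in> \<Gamma>" for \<gamma>
  proof
    have \<gamma>: "fst \<gamma> \<in> topspace Z"
      using that F by (auto simp: \<Gamma>_def)
    then show "i (fst \<gamma>) \<in> I"
      by (rule i)
    show "{z \<in> topspace Z. \<pi> \<gamma> z \<in> {0<..1}} \<subseteq> U (i (fst \<gamma>))"
      using zero[OF \<gamma>] interior_of_subset[of Z "U (i (fst \<gamma>))"] by (force simp: \<pi>_def)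
  qed
  ultimately show ?thesis
    unfolding numerable_covering_def using cov by blast
qed

section \<open>Coverings of locally compact Hausdorff spaces\<close>

lemma locally_compact_Hausdorff_imp_p_numerable_covering:
  assumes "locally_compact_space X" "Hausdorff_space X"
    and cov: "covering X A C" and interiors: "covering X A (\<lambda>\<alpha>. X interior_of C \<alpha>)"
    and \<alpha>: "\<alpha> \<in> A" "compactin X (topspace X - X interior_of C \<alpha>)"
  shows "p_numerable_covering X A C"
proof -
  let ?Z = "Alexandroff_compactification X" and ?U = "\<lambda>\<beta>. insert None (Some ` C \<beta>)"
  have "completely_regular_space ?Z"
    using assms(1,2) completely_regular_space_Alexandroff_compactification
      locally_compact_regular_imp_completely_regular_space by blast
  moreover have "covering ?Z A ?U"
    using cov \<alpha>(1) by (fastforce simp: covering_def)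
  moreover have "topspace ?Z \<subseteq> (\<Union>\<beta>\<in>A. ?Z interior_of ?U \<beta>)"
  proof -
    have "Some ` (X interior_of C \<beta>) \<subseteq> ?Z interior_of ?U \<beta>" for \<beta>
      using interior_of_subset[of X "C \<beta>"] by (intro interior_of_maximal) auto
    then have "Some ` (\<Union>\<beta>\<in>A. X interior_of C \<beta>) \<subseteq> (\<Union>\<beta>\<in>A. ?Z interior_of ?U \<beta>)"
      unfolding image_UN by (intro UN_mono) auto
    then have "Some ` topspace X \<subseteq> (\<Union>\<beta>\<in>A. ?Z interior_of ?U \<beta>)"
      using interiors by (simp add: covering_def)
    moreover have "None \<in> ?Z interior_of ?U \<alpha>"
    proof -
      let ?K = "topspace X - X interior_of C \<alpha>"
      have "topspace X - ?K = X interior_of C \<alpha>"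
        using interior_of_subset_topspace by (metis double_diff subset_refl)
      moreover have "closedin X ?K"
        by (intro closedin_diff) auto
      ultimately have "openin ?Z (insert None (Some ` (X interior_of C \<alpha>)))"
        using \<alpha>(2) by (metis openin_Alexandroff_compactification)
      moreover have "insert None (Some ` (X interior_of C \<alpha>)) \<subseteq> ?U \<alpha>"
        using interior_of_subset[of X "C \<alpha>"] by blast
      ultimately have "insert None (Some ` (X interior_of C \<alpha>)) \<subseteq> ?Z interior_of ?U \<alpha>"
        by (intro interior_of_maximal)
      then show ?thesis
        by blast
    qed
    ultimately show ?thesis
      using \<alpha>(1) by auto
  qed
  ultimately have "numerable_covering ?Z A ?U"
    by (intro compact_completely_regular_imp_numerable_covering) auto
  then show ?thesis
    using cov by (simp add: p_numerable_covering_def)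
qed

section \<open>Local compactness of locally finite CW-complexes\<close>

text \<open>
  The disk is a closed subset of the infinite cube \<open>[-1, 1]\<^sup>\<nat>\<close>, which is compact by
  Tychonoff's theorem.
\<close>

lemma compact_space_unit_disk: "compact_space (unit_disk n)"
proof -
  let ?E = "topspace (Euclidean_space n)" and ?B = "{x::nat \<Rightarrow> real. (\<Sum>i<n. (x i)\<^sup>2) \<le> 1}"
  have "closedin (powertop_real UNIV) ?B"
    by (simp add: euclidean_product_topology flip: closed_closedin)
       (intro closed_Collect_le continuous_intros continuous_on_product_coordinates)
  then have closed: "closedin (powertop_real UNIV) (?E \<inter> ?B)"
    using closedin_Euclidean_space by blast
  have "?E \<inter> ?B \<subseteq> (UNIV \<rightarrow>\<^sub>E {-1..1})"
  proof
    fix x assume x: "x \<in> ?E \<inter> ?B"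
    have "x i \<in> {-1..1}" for i
    proof (cases "i < n")
      case True
      then have "(x i)\<^sup>2 \<le> (\<Sum>i<n. (x i)\<^sup>2)"
        by (intro member_le_sum) auto
      then have "(x i)\<^sup>2 \<le> 1"
        using x by auto
      then show ?thesis
        by (simp add: abs_square_le_1 abs_le_iff)
    next
      case False
      then show ?thesis
        using x by (simp add: topspace_Euclidean_space)
    qed
    then show "x \<in> (UNIV \<rightarrow>\<^sub>E {-1..1})"
      by auto
  qed
  moreover have "compactin (powertop_real UNIV) (UNIV \<rightarrow>\<^sub>E {-1..1})"
    by (simp add: compactin_PiE)
  ultimately have "compactin (powertop_real UNIV) (?E \<inter> ?B)"
    using closed closed_compactin by blast
  moreover have "unit_disk n = subtopology (powertop_real UNIV) (?E \<inter> ?B)"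
    unfolding unit_disk_def topspace_Euclidean_space
    by (simp add: Euclidean_space_def subtopology_subtopology)
  ultimately show ?thesis
    by (simp add: compact_space_subtopology)
qed

lemma characteristic_map_imp_cell_subset_compactin:
  assumes \<phi>: "characteristic_map X e n \<phi>" and "e \<subseteq> topspace X"
  shows "\<exists>K. compactin X K \<and> e \<subseteq> K"
proof (intro exI conjI)
  have "continuous_map (unit_disk n) X \<phi>"
    using \<phi> by (simp add: characteristic_map_def)
  then show "compactin X (\<phi> ` topspace (unit_disk n))"
    using compact_space_unit_disk unfolding compact_space_def by (rule image_compactin[rotated])
  have "\<phi> ` topspace (subtopology (unit_disk n) (open_unit_disk n)) = topspace (subtopology X e)"
    using \<phi> by (intro homeomorphic_imp_surjective_map) (simp add: characteristic_map_def)
  then show "e \<subseteq> \<phi> ` topspace (unit_disk n)"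
    using assms(2) by auto
qed

lemma locally_finite_cw_complex_imp_locally_compact:
  assumes cw: "cw_complex X \<E> d" and fin: "locally_finite_in X \<E>"
  shows "locally_compact_space X"
  unfolding locally_compact_space_def
proof
  fix x assume "x \<in> topspace X"
  then obtain V where V: "openin X V" "x \<in> V" "finite {e \<in> \<E>. e \<inter> V \<noteq> {}}"
    using fin unfolding locally_finite_in_def by blast
  have Union: "\<Union>\<E> = topspace X"
    using cw by (simp add: cw_complex_def partition_on_def)
  have "\<exists>K. compactin X K \<and> e \<subseteq> K" if "e \<in> \<E>" for e
  proof -
    obtain \<phi> where "characteristic_map X e (d e) \<phi>"
      using cw \<open>e \<in> \<E>\<close> by (auto simp: cw_complex_def)
    then show ?thesis
      using Union \<open>e \<in> \<E>\<close> by (intro characteristic_map_imp_cell_subset_compactin) auto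
  qed
  then obtain K where K: "\<And>e. e \<in> \<E> \<Longrightarrow> compactin X (K e)" "\<And>e. e \<in> \<E> \<Longrightarrow> e \<subseteq> K e"
    by metis
  let ?K = "\<Union>(K ` {e \<in> \<E>. e \<inter> V \<noteq> {}})"
  have "compactin X ?K"
    using V(3) K(1) by (intro compactin_Union) auto
  moreover have "V \<subseteq> ?K"
    using openin_subset[OF V(1)] Union K(2) by blast
  ultimately show "\<exists>U K. openin X U \<and> compactin X K \<and> x \<in> U \<and> U \<subseteq> K"
    using V(1,2) by blast
qed

section \<open>Coverings of locally finite CW-complexes\<close>

theorem proposition16:
  fixes X :: "'a topology" and \<E> :: "'a set set" and d :: "'a set \<Rightarrow> nat"
  assumes "cw_complex X \<E> d"
    and finite_dimensional: "bdd_above (d ` \<E>)"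
    and locally_finite: "locally_finite_in X \<E>"
  shows "paracompact_space (Alexandroff_compactification X) \<and>
    (\<forall>(A :: 'i set) C. covering X A C \<and>
        covering X A (\<lambda>\<alpha>. X interior_of C \<alpha>) \<and>
        (\<exists>\<alpha>\<in>A. compactin X (topspace X - X interior_of C \<alpha>)) \<longrightarrow>
      p_numerable_covering X A C)"
proof -
  have "locally_compact_space X"
    using assms(1) locally_finite by (rule locally_finite_cw_complex_imp_locally_compact)
  moreover have "Hausdorff_space X"
    using assms(1) by (simp add: cw_complex_def)
  ultimately have "p_numerable_covering X A C"
    if "covering X A C" "covering X A (\<lambda>\<alpha>. X interior_of C \<alpha>)"
      "\<exists>\<alpha>\<in>A. compactin X (topspace X - X interior_of C \<alpha>)" for A :: "'i set" and C
    using that locally_compact_Hausdorff_imp_p_numerable_covering by auto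
  then show ?thesis
    by (simp add: compact_imp_paracompact_space)
qed

end
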